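(* There exists an $\omega$-algebraic domain $P$ such that the set $\mathrm{Max}(P)$ of all maximal elements of $P$ is not a $G_\delta$-set of the Scott space $\Sigma P = (P,\sigma(P))$.
   Context: Let $P$ be a poset. A nonempty subset $D\subseteq P$ is directed if every two elements of $D$ have an upper bound in $D$. A dcpo is a poset in which every directed subset has a supremum. For $x,y\in P$, $x$ is way-below $y$, written $x\ll y$, if for each directed subset $D$ of $P$ whose supremum $\bigvee D$ exists, $y\le\bigvee D$ implies $x\le d$ for some $d\in D$. An element $a\in P$ is compact if $a\ll a$; $K(P)$ denotes the set of compact elements of $P$. The poset $P$ is algebraic if for each $x\in P$ the set $\{a\in K(P): a\le x\}$ is directed and has supremum $x$. An algebraic domain is an algebraic dcpo. A subset $B\subseteq P$ is a base of $P$ if for each $x\in P$ the set $\{b\in B: b\ll x\}$ is directed with supremum $x$. An $\omega$-algebraic domain is an algebraic domain which has a countable base; equivalently, an algebraic domain $P$ for which $K(P)$ is countable. An element $x\in P$ is maximal if $\{y\in P: x\le y\}=\{x\}$; $\mathrm{Max}(P)$ is the set of all maximal elements of $P$. A subset $U\subseteq P$ is Scott open if (i) $U$ is an upper set (if $x\in U$ and $x\le y$ then $y\in U$), and (ii) for each directed subset $D$ of $P$ for which $\bigvee D$ exists, $\bigvee D\in U$ implies $D\cap U\ne\emptyset$. The Scott open sets form a topology $\sigma(P)$ on $P$, and $\Sigma P=(P,\sigma(P))$ is the Scott space of $P$. A subset $G$ of a topological space is a $G_\delta$-set if $G=\bigcap_{n\in\mathbb N}U_n$ for some countable family $\{U_n:n\in\mathbb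 N\}$ of open sets. *)

theory Defs
  imports "HOL-Algebra.Order" "HOL-Analysis.FSigma"
begin

text \<open>
  A poset is an order record \<open>P\<close> satisfying \<open>partial_order P\<close>; its underlying set is
  \<open>carrier P\<close>. The relation \<open>is_lub P x A\<close> says that \<open>x\<close> is the supremum of \<open>A\<close> in \<open>P\<close>,
  so that hypotheses of the form ``the supremum of \<open>D\<close> exists'' become quantification
  over \<open>s\<close> with \<open>is_lub P s D\<close>.

  Existence of an \<open>\<omega>\<close>-algebraic domain is stated over carriers inside the type
  \<open>nat set\<close>. This loses nothing: sending \<open>x\<close> to the set of compact elements below it
  embeds any such domain into the powerset of a countable set.
\<close>

definition directed_in :: "'a gorder \<Rightarrow> 'a set \<Rightarrow> bool" where
  "directed_in P D \<longleftrightarrow>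
     D \<noteq> {} \<and> D \<subseteq> carrier P \<and>
     (\<forall>x\<in>D. \<forall>y\<in>D. \<exists>z\<in>D. x \<sqsubseteq>\<^bsub>P\<^esub> z \<and> y \<sqsubseteq>\<^bsub>P\<^esub> z)"

definition dcpo :: "'a gorder \<Rightarrow> bool" where
  "dcpo P \<longleftrightarrow> partial_order P \<and> (\<forall>D. directed_in P D \<longrightarrow> (\<exists>s. is_lub P s D))"

definition way_below :: "'a gorder \<Rightarrow> 'a \<Rightarrow> 'a \<Rightarrow> bool" where
  "way_below P x y \<longleftrightarrow>
     x \<in> carrier P \<and> y \<in> carrier P \<and>
     (\<forall>D s. directed_in P D \<longrightarrow> is_lub P s D \<longrightarrow> y \<sqsubseteq>\<^bsub>P\<^esub> s \<longrightarrow> (\<exists>d\<in>D. x \<sqsubseteq>\<^bsub>P\<^esub> d))"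

definition compact_elements :: "'a gorder \<Rightarrow> 'a set" where
  "compact_elements P = {a \<in> carrier P. way_below P a a}"

definition algebraic_poset :: "'a gorder \<Rightarrow> bool" where
  "algebraic_poset P \<longleftrightarrow>
     partial_order P \<and>
     (\<forall>x\<in>carrier P.
        directed_in P {a \<in> compact_elements P. a \<sqsubseteq>\<^bsub>P\<^esub> x} \<and>
        is_lub P x {a \<in> compact_elements P. a \<sqsubseteq>\<^bsub>P\<^esub> x})"

definition algebraic_domain :: "'a gorder \<Rightarrow> bool" where
  "algebraic_domain P \<longleftrightarrow> algebraic_poset P \<and> dcpo P"

definition poset_base :: "'a gorder \<Rightarrow> 'a set \<Rightarrow> bool" where
  "poset_base P B \<longleftrightarrow>
     B \<subseteq> carrier P \<and>
     (\<forall>x\<in>carrier P.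
        directed_in P {b \<in> B. way_below P b x} \<and> is_lub P x {b \<in> B. way_below P b x})"

definition omega_algebraic_domain :: "'a gorder \<Rightarrow> bool" where
  "omega_algebraic_domain P \<longleftrightarrow>
     algebraic_domain P \<and> (\<exists>B. countable B \<and> poset_base P B)"

definition maximal_elements :: "'a gorder \<Rightarrow> 'a set" where
  "maximal_elements P = {x \<in> carrier P. {y \<in> carrier P. x \<sqsubseteq>\<^bsub>P\<^esub> y} = {x}}"

definition scott_open :: "'a gorder \<Rightarrow> 'a set \<Rightarrow> bool" where
  "scott_open P U \<longleftrightarrow>
     U \<subseteq> carrier P \<and>
     (\<forall>x\<in>U. \<forall>y\<in>carrier P. x \<sqsubseteq>\<^bsub>P\<^esub> y \<longrightarrow> y \<in> U) \<and>
     (\<forall>D s. directed_in P D \<longrightarrow> is_lub P s D \<longrightarrow> s \<in> U \<longrightarrow> D \<inter> U \<noteq> {})"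

definition scott_space :: "'a gorder \<Rightarrow> 'a topology" where
  "scott_space P = topology (scott_open P)"

lemma scott_open_Int:
  assumes "scott_open P U" "scott_open P V"
  shows "scott_open P (U \<inter> V)"
  unfolding scott_open_def
proof (intro conjI allI impI ballI)
  show "U \<inter> V \<subseteq> carrier P"
    using assms by (auto simp: scott_open_def)
next
  fix x y assume "x \<in> U \<inter> V" "y \<in> carrier P" "x \<sqsubseteq>\<^bsub>P\<^esub> y"
  then show "y \<in> U \<inter> V"
    using assms unfolding scott_open_def by blast
next
  fix D s assume D: "directed_in P D" and s: "is_lub P s D" "s \<in> U \<inter> V"
  obtain x where x: "x \<in> D" "x \<in> U"
    using assms(1) D s unfolding scott_open_def by blast
  obtain y where y: "y \<in> D" "y \<in> V"
    using assms(2) D s unfolding scott_open_def by blast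
  obtain z where z: "z \<in> D" "x \<sqsubseteq>\<^bsub>P\<^esub> z" "y \<sqsubseteq>\<^bsub>P\<^esub> z" "z \<in> carrier P"
    using D x y unfolding directed_in_def by blast
  have "z \<in> U" "z \<in> V"
    using assms x y z unfolding scott_open_def by blast+
  then show "D \<inter> (U \<inter> V) \<noteq> {}"
    using z by blast
qed

lemma scott_open_Union:
  assumes "\<And>U. U \<in> \<U> \<Longrightarrow> scott_open P U"
  shows "scott_open P (\<Union>\<U>)"
  unfolding scott_open_def
proof (intro conjI allI impI ballI)
  show "\<Union>\<U> \<subseteq> carrier P"
    using assms unfolding scott_open_def by blast
next
  fix x y assume "x \<in> \<Union>\<U>" "y \<in> carrier P" "x \<sqsubseteq>\<^bsub>P\<^esub> y"
  then show "y \<in> \<Union>\<U>"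
    using assms unfolding scott_open_def by blast
next
  fix D s assume D: "directed_in P D" "is_lub P s D" and "s \<in> \<Union>\<U>"
  then obtain U where U: "U \<in> \<U>" "s \<in> U"
    by blast
  then have "D \<inter> U \<noteq> {}"
    using assms[OF U(1)] D unfolding scott_open_def by blast
  then show "D \<inter> \<Union>\<U> \<noteq> {}"
    using U by blast
qed

lemma scott_open_carrier: "scott_open P (carrier P)"
  unfolding scott_open_def directed_in_def by blast

lemma openin_scott_space: "openin (scott_space P) U \<longleftrightarrow> scott_open P U"
proof -
  have "istopology (scott_open P)"
    unfolding istopology_def using scott_open_Int scott_open_Union by blast
  then show ?thesis
    by (simp add: scott_space_def topology_inverse')
qed

lemma topspace_scott_space: "topspace (scott_space P) = carrier P"
  unfolding topspace_def openin_scott_space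
  using scott_open_carrier[of P] by (auto simp: scott_open_def)

lemma gdelta_in_scott_space:
  "gdelta_in (scott_space P) G \<longleftrightarrow>
     (\<exists>U :: nat \<Rightarrow> 'a set. (\<forall>n. scott_open P (U n)) \<and> G = (\<Inter>n. U n))"
  for P :: "'a gorder"
proof
  assume "gdelta_in (scott_space P) G"
  then obtain \<U> where G: "G \<subseteq> carrier P"
    and \<U>: "countable \<U>" "\<U> \<subseteq> Collect (scott_open P)" "\<Inter>\<U> = G"
    unfolding gdelta_in_alt intersection_of_def topspace_scott_space openin_scott_space
    by blast
  let ?V = "insert (carrier P) \<U>"
  have V: "range (from_nat_into ?V) = ?V"
    using \<U>(1) by (intro range_from_nat_into) auto
  have "scott_open P (from_nat_into ?V n)" for n
  proof -
    have "from_nat_into ?V n \<in> ?V"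
      by (rule from_nat_into) simp
    then show ?thesis
      using \<U>(2) scott_open_carrier[of P] by auto
  qed
  moreover have "G = (\<Inter>n. from_nat_into ?V n)"
    unfolding V using \<U>(3) G by auto
  ultimately show "\<exists>U :: nat \<Rightarrow> 'a set. (\<forall>n. scott_open P (U n)) \<and> G = (\<Inter>n. U n)"
    by blast
next
  assume "\<exists>U :: nat \<Rightarrow> 'a set. (\<forall>n. scott_open P (U n)) \<and> G = (\<Inter>n. U n)"
  then obtain U :: "nat \<Rightarrow> 'a set" where U: "\<And>n. scott_open P (U n)" "G = (\<Inter>n. U n)"
    by blast
  show "gdelta_in (scott_space P) G"
    unfolding U(2)
    by (rule gdelta_in_Inter) (auto intro!: open_imp_gdelta_in simp: openin_scott_space U(1))
qed

end

theory Submission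
  imports Defs
begin

text \<open>
  Take partial functions from \<open>nat\<close> to \<open>{0, 1}\<close> ordered by extension, together with a token
  that may be added to such a function only if every argument of value 0 is followed by
  an argument of value 1. Directed unions preserve this condition, and every finite part of a member
  lies in a finite member below it (one further value 1 suffices), so the finite members are the
  compact elements. A total function with finitely many ones does
  not admit the token and is maximal; a total function with infinitely many ones admits it, hence
  is not maximal. If the maximal elements were a \<open>G\<^sub>\<delta>\<close>-set, the finite subsets of \<open>nat\<close> would be a
  \<open>G\<^sub>\<delta>\<close>-set in the Cantor space, which a Baire category argument excludes.
\<close>

section \<open>Families of sets closed under directed unions\<close>

definition inclusion_order :: "'a set set \<Rightarrow> 'a set gorder" where
  "inclusion_order \<F> = \<lparr>carrier = \<F>, eq = (=), le = (\<subseteq>)\<rparr>"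

lemma inclusion_order_simps [simp]:
  "carrier (inclusion_order \<F>) = \<F>"
  "x \<sqsubseteq>\<^bsub>inclusion_order \<F>\<^esub> y \<longleftrightarrow> x \<subseteq> y"
  "x .=\<^bsub>inclusion_order \<F>\<^esub> y \<longleftrightarrow> x = y"
  by (simp_all add: inclusion_order_def)

lemma partial_order_inclusion_order: "partial_order (inclusion_order \<F>)"
  by unfold_locales (auto simp: fun_eq_iff)

lemma directed_in_inclusion_order:
  "directed_in (inclusion_order \<F>) D \<longleftrightarrow>
     D \<noteq> {} \<and> D \<subseteq> \<F> \<and> (\<forall>x\<in>D. \<forall>y\<in>D. \<exists>z\<in>D. x \<subseteq> z \<and> y \<subseteq> z)"
  by (simp add: directed_in_def)

lemma is_lub_inclusion_orderI:
  assumes "D \<subseteq> \<F>" "\<Union>D \<in> \<F>"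
  shows "is_lub (inclusion_order \<F>) (\<Union>D) D"
  using assms unfolding least_def Upper_def by auto

lemma is_lub_inclusion_orderD:
  assumes "is_lub (inclusion_order \<F>) s D" "D \<subseteq> \<F>" "\<Union>D \<in> \<F>"
  shows "s = \<Union>D"
proof -
  have "Upper (inclusion_order \<F>) D = {u \<in> \<F>. \<Union>D \<subseteq> u}"
    using assms(2) by (auto simp: Upper_def)
  then have "\<Union>D \<subseteq> s" "s \<subseteq> \<Union>D"
    using assms(1,3) by (simp_all add: least_def)
  then show ?thesis by blast
qed

text \<open>Directedness merges the finitely many members of \<open>D\<close> that catch the single
  elements of \<open>E\<close>. This is the source of the compactness of finite members.\<close>

lemma directed_finite_subset:
  assumes "directed_in (inclusion_order \<F>) D" "finite E" "E \<subseteq> \<Union>D"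
  shows "\<exists>d\<in>D. E \<subseteq> d"
  using assms(2,3)
proof (induction E rule: finite_induct)
  case empty
  then show ?case using assms(1) by (auto simp: directed_in_inclusion_order)
next
  case (insert e E)
  then obtain d d' where "d \<in> D" "E \<subseteq> d" "d' \<in> D" "e \<in> d'" by auto
  moreover then obtain z where "z \<in> D" "d \<subseteq> z" "d' \<subseteq> z"
    using assms(1) unfolding directed_in_inclusion_order by meson
  ultimately show ?case by blast
qed

text \<open>The first axiom makes directed suprema unions; the second makes the finite members below
  \<open>x\<close> directed with union \<open>x\<close>. There \<open>E\<close> ranges over all
  finite subsets of \<open>x\<close>, so that it can be a singleton or the union of two finite
  members.\<close>

locale finitary_family =
  fixes \<F> :: "'a set set"
  assumes directed_Union: "directed_in (inclusion_order \<F>) D \<Longrightarrow> \<Union>D \<in> \<F>"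
    and finite_approx: "x \<in> \<F> \<Longrightarrow> finite E \<Longrightarrow> E \<subseteq> x \<Longrightarrow> \<exists>b\<in>\<F>. finite b \<and> E \<subseteq> b \<and> b \<subseteq> x"
begin

abbreviation "P \<equiv> inclusion_order \<F>"

lemma is_lub_directed_iff:
  assumes "directed_in P D"
  shows "is_lub P s D \<longleftrightarrow> s = \<Union>D"
  using assms directed_Union[OF assms] is_lub_inclusion_orderI is_lub_inclusion_orderD
  unfolding directed_in_inclusion_order by metis

lemma directed_finite_below:
  assumes "x \<in> \<F>"
  shows "directed_in P {b \<in> \<F>. finite b \<and> b \<subseteq> x}"
  unfolding directed_in_inclusion_order
proof (intro conjI ballI)
  show "{b \<in> \<F>. finite b \<and> b \<subseteq> x} \<noteq> {}"
    using finite_approx[OF assms, of "{}"] by auto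
next
  fix a b assume "a \<in> {b \<in> \<F>. finite b \<and> b \<subseteq> x}" "b \<in> {b \<in> \<F>. finite b \<and> b \<subseteq> x}"
  then show "\<exists>c\<in>{b \<in> \<F>. finite b \<and> b \<subseteq> x}. a \<subseteq> c \<and> b \<subseteq> c"
    using finite_approx[OF assms, of "a \<union> b"] by auto
qed auto

lemma Union_finite_below:
  assumes "x \<in> \<F>"
  shows "\<Union>{b \<in> \<F>. finite b \<and> b \<subseteq> x} = x"
proof (intro equalityI subsetI)
  fix e assume "e \<in> x"
  then show "e \<in> \<Union>{b \<in> \<F>. finite b \<and> b \<subseteq> x}"
    using finite_approx[OF assms, of "{e}"] by auto
qed auto

lemma is_lub_finite_below:
  assumes "x \<in> \<F>"
  shows "is_lub P x {b \<in> \<F>. finite b \<and> b \<subseteq> x}"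
  by (simp add: is_lub_directed_iff[OF directed_finite_below[OF assms]]
      Union_finite_below[OF assms])

lemma way_below_finite_iff:
  assumes "b \<in> \<F>" "finite b" "x \<in> \<F>"
  shows "way_below P b x \<longleftrightarrow> b \<subseteq> x"
proof
  \<comment> \<open>Testing the way-below relation on this directed set, whose supremum is
    \<open>x\<close>, yields the inclusion.\<close>
  have "directed_in P {x}"
    using assms by (auto simp: directed_in_inclusion_order)
  moreover assume "way_below P b x"
  ultimately show "b \<subseteq> x"
    unfolding way_below_def using is_lub_directed_iff[of "{x}" x] by auto
next
  assume "b \<subseteq> x"
  show "way_below P b x"
    unfolding way_below_def
  proof (intro conjI allI impI)
    fix D s assume D: "directed_in P D" "is_lub P s D" "x \<sqsubseteq>\<^bsub>P\<^esub> s"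
    then have "b \<subseteq> \<Union>D"
      using \<open>b \<subseteq> x\<close> is_lub_directed_iff by auto
    then show "\<exists>d\<in>D. b \<sqsubseteq>\<^bsub>P\<^esub> d"
      using directed_finite_subset[OF D(1) assms(2)] by simp
  qed (use assms in auto)
qed

text \<open>A compact \<open>a\<close> is the directed supremum of the finite members below it, so
  it is contained in one of them and hence equals it.\<close>

lemma compact_elements_eq: "compact_elements P = {b \<in> \<F>. finite b}"
proof (intro equalityI subsetI)
  fix a assume "a \<in> compact_elements P"
  then have a: "a \<in> \<F>" "way_below P a a"
    by (auto simp: compact_elements_def)
  then obtain b where "finite b" "b \<subseteq> a" "a \<subseteq> b"
    using directed_finite_below[OF a(1)] is_lub_finite_below[OF a(1)]
    unfolding way_below_def by fastforce
  then show "a \<in> {b \<in> \<F>. finite b}"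
    using a by auto
qed (simp add: compact_elements_def way_below_finite_iff)

lemma algebraic_domain_inclusion_order: "algebraic_domain P"
proof -
  have *: "{a \<in> compact_elements P. a \<sqsubseteq>\<^bsub>P\<^esub> x} = {b \<in> \<F>. finite b \<and> b \<subseteq> x}" for x
    by (auto simp: compact_elements_eq)
  show ?thesis
    unfolding algebraic_domain_def algebraic_poset_def dcpo_def *
    using partial_order_inclusion_order directed_finite_below is_lub_finite_below
      is_lub_directed_iff by auto
qed

lemma poset_base_finite: "poset_base P {b \<in> \<F>. finite b}"
proof -
  have *: "{b \<in> {b \<in> \<F>. finite b}. way_below P b x} = {b \<in> \<F>. finite b \<and> b \<subseteq> x}"
    if "x \<in> \<F>" for x
    using way_below_finite_iff that by auto
  show ?thesis
    unfolding poset_base_def inclusion_order_simps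
  proof (intro conjI ballI)
    fix x assume x: "x \<in> \<F>"
    show "directed_in P {b \<in> {b \<in> \<F>. finite b}. way_below P b x}"
      using directed_finite_below[OF x] by (simp only: *[OF x])
    show "is_lub P x {b \<in> {b \<in> \<F>. finite b}. way_below P b x}"
      using is_lub_finite_below[OF x] by (simp only: *[OF x])
  qed auto
qed

text \<open>As \<open>x\<close> is the directed supremum of the finite members below it, one of them
  lies in \<open>U\<close>; the rest is upward closure.\<close>

lemma scott_open_finite_witness:
  assumes "scott_open P U" "x \<in> U"
  obtains b where "finite b" "b \<subseteq> x" "\<And>y. y \<in> \<F> \<Longrightarrow> b \<subseteq> y \<Longrightarrow> y \<in> U"
proof -
  have x: "x \<in> \<F>"
    using assms by (auto simp: scott_open_def)
  then obtain b where "b \<in> U" "finite b" "b \<subseteq> x"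
    using assms directed_finite_below[OF x] is_lub_finite_below[OF x]
    unfolding scott_open_def by blast
  moreover have "y \<in> U" if "y \<in> \<F>" "b \<subseteq> y" for y
    using assms(1) \<open>b \<in> U\<close> that unfolding scott_open_def by auto
  ultimately show thesis
    using that by blast
qed

lemma omega_algebraic_domain_inclusion_order:
  assumes "countable (\<Union>\<F>)"
  shows "omega_algebraic_domain P"
proof -
  have "countable {b \<in> \<F>. finite b}"
    by (rule countable_subset[OF _ countable_Collect_finite_subset[OF assms]]) auto
  then show ?thesis
    unfolding omega_algebraic_domain_def
    using algebraic_domain_inclusion_order poset_base_finite by blast
qed

end

section \<open>The domain\<close>

text \<open>
  The numbers \<open>2 * k + 1\<close> and \<open>2 * k + 2\<close> say that the value at \<open>k\<close> is 0 and 1, respectively; the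
  number 0 is the token.
\<close>

definition token_family :: "nat set set" where
  "token_family = {S. (\<forall>k. \<not> (2 * k + 1 \<in> S \<and> 2 * k + 2 \<in> S)) \<and>
     (0 \<in> S \<longrightarrow> (\<forall>k. 2 * k + 1 \<in> S \<longrightarrow> (\<exists>j>k. 2 * j + 2 \<in> S)))}"

lemma token_familyI:
  assumes "\<And>k. 2 * k + 1 \<in> S \<Longrightarrow> 2 * k + 2 \<notin> S"
    and "\<And>k. 0 \<in> S \<Longrightarrow> 2 * k + 1 \<in> S \<Longrightarrow> \<exists>j>k. 2 * j + 2 \<in> S"
  shows "S \<in> token_family"
  using assms unfolding token_family_def by simp

lemma token_familyD:
  assumes "S \<in> token_family" "2 * k + 1 \<in> S"
  shows "2 * k + 2 \<notin> S" and "0 \<in> S \<Longrightarrow> \<exists>j>k. 2 * j + 2 \<in> S"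
  using assms unfolding token_family_def by simp_all

interpretation token: finitary_family token_family
proof
  fix D assume D: "directed_in (inclusion_order token_family) D"
  then have sub: "D \<subseteq> token_family"
    by (simp add: directed_in_inclusion_order)
  \<comment> \<open>Both conditions start from a pair of elements, which directedness places in a
    common member of \<open>D\<close>; a witness found there survives in the union.\<close>
  have pair: "\<exists>d\<in>D. a \<in> d \<and> b \<in> d" if "a \<in> \<Union>D" "b \<in> \<Union>D" for a b
    using directed_finite_subset[OF D, of "{a, b}"] that by auto
  show "\<Union>D \<in> token_family"
  proof (rule token_familyI)
    fix k assume one: "2 * k + 1 \<in> \<Union>D"
    show "2 * k + 2 \<notin> \<Union>D"
    proof
      assume "2 * k + 2 \<in> \<Union>D"
      with pair[OF one] obtain d where "d \<in> D" "2 * k + 1 \<in> d" "2 * k + 2 \<in> d"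
        by metis
      with sub token_familyD(1) show False by (metis subsetD)
    qed
    assume "0 \<in> \<Union>D"
    with pair[OF one] obtain d where "d \<in> D" "2 * k + 1 \<in> d" "0 \<in> d"
      by metis
    with sub token_familyD(2)[of d k] show "\<exists>j>k. 2 * j + 2 \<in> \<Union>D" by (meson UnionI subsetD)
  qed
next
  fix x E :: "nat set"
  assume x: "x \<in> token_family" and E: "finite E" "E \<subseteq> x"
  show "\<exists>b\<in>token_family. finite b \<and> E \<subseteq> b \<and> b \<subseteq> x"
  proof (cases "0 \<in> E \<and> (\<exists>k. 2 * k + 1 \<in> E)")
    \<comment> \<open>The second condition is vacuous here, so \<open>E\<close> itself
      serves.\<close>
    case False
    then have "E \<in> token_family"
      using token_familyD(1)[OF x] E(2) by (intro token_familyI) (metis subsetD)+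
    with E show ?thesis by blast
  next
    case True
    \<comment> \<open>These are the arguments of value 0 in \<open>E\<close>. A value 1 of
      \<open>x\<close> beyond the largest of them serves all of them at once.\<close>
    define K where "K = {k. 2 * k + 1 \<in> E}"
    have "finite K"
      unfolding K_def using finite_vimageI[OF E(1), of "\<lambda>k. 2 * k + 1"]
      by (auto simp: vimage_def inj_on_def)
    moreover have "K \<noteq> {}"
      using True by (auto simp: K_def)
    ultimately have "Max K \<in> K" and le: "\<And>k. k \<in> K \<Longrightarrow> k \<le> Max K"
      by auto
    then have "2 * Max K + 1 \<in> x" "0 \<in> x"
      using True E(2) by (auto simp only: K_def mem_Collect_eq)
    then obtain j where j: "j > Max K" "2 * j + 2 \<in> x"
      using token_familyD(2)[OF x] by metis
    let ?b = "insert (2 * j + 2) E"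
    have "?b \<subseteq> x"
      using j E(2) by auto
    have "\<exists>i>k. 2 * i + 2 \<in> ?b" if "2 * k + 1 \<in> ?b" for k
    proof -
      have "2 * k + 1 \<noteq> 2 * j + 2"
        by presburger
      then have "k \<in> K"
        using that by (simp add: K_def)
      then have "k < j"
        using le[of k] j(1) by simp
      then show ?thesis by blast
    qed
    then have "?b \<in> token_family"
      using token_familyD(1)[OF x] \<open>?b \<subseteq> x\<close> by (intro token_familyI) (metis subsetD)+
    with \<open>?b \<subseteq> x\<close> E(1) show ?thesis
      by (intro bexI[of _ ?b]) auto
  qed
qed

text \<open>This is the graph of the characteristic function of \<open>A\<close>, without the token.
  It places the Cantor space, coded by subsets of \<open>nat\<close>, inside the family.\<close>

definition total_member :: "nat set \<Rightarrow> nat set" where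
  "total_member A = (\<lambda>k. 2 * k + 2) ` A \<union> (\<lambda>k. 2 * k + 1) ` (- A)"

lemma total_member_simps [simp]:
  "2 * k + 1 \<in> total_member A \<longleftrightarrow> k \<notin> A"
  "2 * k + 2 \<in> total_member A \<longleftrightarrow> k \<in> A"
  "0 \<notin> total_member A"
proof -
  have "2 * k + 1 \<noteq> 2 * j + 2" for j :: nat
    by presburger
  then show "2 * k + 1 \<in> total_member A \<longleftrightarrow> k \<notin> A"
    unfolding total_member_def by auto
  have "2 * k + 2 \<noteq> 2 * j + 1" for j :: nat
    by presburger
  then show "2 * k + 2 \<in> total_member A \<longleftrightarrow> k \<in> A"
    unfolding total_member_def by auto
qed (auto simp: total_member_def)

lemma total_member_in_family: "total_member A \<in> token_family"
  by (rule token_familyI) (simp_all only: total_member_simps not_True_eq_False not_False_eq_True)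

text \<open>All arguments already have values, so only the token could be added.\<close>

lemma total_member_maximal_if_finite:
  assumes "finite A"
  shows "total_member A \<in> maximal_elements (inclusion_order token_family)"
proof -
  have "T \<subseteq> total_member A" if T: "T \<in> token_family" "total_member A \<subseteq> T" for T
  proof
    obtain m where m: "\<And>k. k \<in> A \<Longrightarrow> k < m"
      using assms finite_nat_set_iff_bounded by auto
    have disj: "\<not> (2 * k + 1 \<in> T \<and> 2 * k + 2 \<in> T)" for k
      using token_familyD(1)[OF T(1)] by blast
    have one: "k \<in> A" if "2 * k + 2 \<in> T" for k
      using disj[of k] that T(2) total_member_simps(1)[of k A] by blast
    have zero: "k \<notin> A" if "2 * k + 1 \<in> T" for k
      using disj[of k] that T(2) total_member_simps(2)[of k A] by blast
    \<comment> \<open>As \<open>A\<close> lies below \<open>m\<close>, the argument \<open>m\<close>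
      has value 0 and no later argument has value 1; this keeps the token out of
      \<open>T\<close>.\<close>
    have "m \<notin> A"
      using m by blast
    then have "2 * m + 1 \<in> T"
      using T(2) total_member_simps(1)[of m A] by blast
    moreover have "\<not> (\<exists>j>m. 2 * j + 2 \<in> T)"
      using one m by (meson order.asym)
    ultimately have "0 \<notin> T"
      using token_familyD(2)[OF T(1)] by blast
    fix e assume e: "e \<in> T"
    with \<open>0 \<notin> T\<close> have "e \<noteq> 0"
      by metis
    then have "\<exists>k. e = 2 * k + 1 \<or> e = 2 * k + 2"
      by presburger
    then show "e \<in> total_member A"
      using e one zero total_member_simps by metis
  qed
  then show ?thesis
    using total_member_in_family unfolding maximal_elements_def by auto
qed

text \<open>Every argument is followed by one of value 1, so adding the token gives a strictly
  larger member.\<close>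

lemma total_member_not_maximal_if_infinite:
  assumes "infinite A"
  shows "total_member A \<notin> maximal_elements (inclusion_order token_family)"
proof
  assume max: "total_member A \<in> maximal_elements (inclusion_order token_family)"
  have "insert 0 (total_member A) \<in> token_family"
  proof (rule token_familyI)
    fix k
    have "\<exists>j>k. j \<in> A"
      using assms infinite_nat_iff_unbounded by blast
    then show "\<exists>j>k. 2 * j + 2 \<in> insert 0 (total_member A)"
      using total_member_simps(2) by blast
  next
    fix k assume "2 * k + 1 \<in> insert 0 (total_member A)"
    then show "2 * k + 2 \<notin> insert 0 (total_member A)"
      using total_member_simps(1,2)[of k A] by simp
  qed
  then have "insert 0 (total_member A) \<in> {y \<in> token_family. total_member A \<subseteq> y}"
    by blast
  moreover have "{y \<in> token_family. total_member A \<subseteq> y} = {total_member A}"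
    using max by (simp add: maximal_elements_def)
  ultimately have "insert 0 (total_member A) = total_member A"
    by (simp only: singleton_iff)
  then show False
    using total_member_simps(3) by blast
qed

text \<open>This is continuity of \<open>total_member\<close> on the Cantor space: a finite witness
  for membership in \<open>U\<close> involves only finitely many arguments.\<close>

lemma scott_open_total_member:
  assumes "scott_open (inclusion_order token_family) U" "total_member A \<in> U"
  shows "\<exists>m. \<forall>B. B \<inter> {..<m} = A \<inter> {..<m} \<longrightarrow> total_member B \<in> U"
proof -
  obtain b where b: "finite b" "b \<subseteq> total_member A"
    "\<And>y. y \<in> token_family \<Longrightarrow> b \<subseteq> y \<Longrightarrow> y \<in> U"
    using token.scott_open_finite_witness[OF assms] by blast
  obtain m where m: "\<And>e. e \<in> b \<Longrightarrow> e < m"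
    using b(1) finite_nat_set_iff_bounded by auto
  have "total_member B \<in> U" if B: "B \<inter> {..<m} = A \<inter> {..<m}" for B
  proof (rule b(3)[OF total_member_in_family], rule subsetI)
    fix e assume e: "e \<in> b"
    then obtain k where k: "e = 2 * k + 2 \<and> k \<in> A \<or> e = 2 * k + 1 \<and> k \<notin> A"
      using b(2) unfolding total_member_def by blast
    \<comment> \<open>The bound \<open>m\<close> is on the codes in \<open>b\<close>, and an
      argument is smaller than its code.\<close>
    then have "k < m"
      using m[OF e] by auto
    then have "k \<in> A \<longleftrightarrow> k \<in> B"
      using B by blast
    then show "e \<in> total_member B"
      using k total_member_simps by metis
  qed
  then show ?thesis by blast
qed

section \<open>The Baire category argument\<close>

text \<open>Here \<open>opn\<close> is openness in the Cantor space and \<open>fin\<close> provides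
  a dense set. Finite approximations are extended so that their limit enters every
  \<open>V n\<close> and gains infinitely many elements.\<close>

lemma infinite_set_in_countable_Int:
  fixes V :: "nat \<Rightarrow> nat set set"
  assumes opn: "\<And>n A. A \<in> V n \<Longrightarrow> \<exists>m. \<forall>B. B \<inter> {..<m} = A \<inter> {..<m} \<longrightarrow> B \<in> V n"
    and fin: "\<And>n A. finite A \<Longrightarrow> A \<in> V n"
  shows "\<exists>B. infinite B \<and> (\<forall>n. B \<in> V n)"
proof -
  \<comment> \<open>A pair \<open>(A, m)\<close> prescribes the limit below \<open>m\<close>. Step
    \<open>n\<close> keeps this, adds an element at or above \<open>m\<close>, and forces membership
    in \<open>V n\<close>.\<close>
  let ?inv = "\<lambda>(A, m). A \<subseteq> {..<m::nat}"
  let ?step = "\<lambda>n (A, m) (A', m'). A' \<inter> {..<m} = A \<and> m < m' \<and> (\<exists>k\<ge>m. k \<in> A') \<and>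
    (\<forall>B. B \<inter> {..<m'} = A' \<longrightarrow> B \<in> V n)"
  have "\<exists>f. \<forall>n. ?inv (f n) \<and> ?step n (f n) (f (Suc n))"
  proof (rule dependent_nat_choice)
    show "\<exists>p. ?inv p"
      by (intro exI[of _ "({}, 0)"]) simp
  next
    fix p :: "nat set \<times> nat" and n
    obtain A m where p: "p = (A, m)" by (cases p)
    assume "?inv p"
    then have A: "A \<subseteq> {..<m}" by (simp add: p)
    let ?A = "insert m A"
    have "finite ?A"
      using A finite_subset by auto
    then obtain l where l: "\<And>B. B \<inter> {..<l} = ?A \<inter> {..<l} \<Longrightarrow> B \<in> V n"
      using opn[OF fin] by meson
    \<comment> \<open>\<open>Suc m\<close> keeps the new element \<open>m\<close> below the new
      bound; \<open>l\<close> secures membership in \<open>V n\<close>.\<close>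
    let ?m = "max l (Suc m)"
    have "B \<in> V n" if "B \<inter> {..<?m} = ?A" for B
    proof (rule l)
      have "B \<inter> {..<l} = (B \<inter> {..<?m}) \<inter> {..<l}" by auto
      then show "B \<inter> {..<l} = ?A \<inter> {..<l}" by (simp only: that)
    qed
    then show "\<exists>q. ?inv q \<and> ?step n p q"
      using A by (intro exI[of _ "(?A, ?m)"]) (auto simp: p)
  qed
  then obtain f where f: "\<forall>n. ?inv (f n) \<and> ?step n (f n) (f (Suc n))" ..
  define A m where "A = (\<lambda>n. fst (f n))" and "m = (\<lambda>n. snd (f n))"
  have A: "A n \<subseteq> {..<m n}" "A (Suc n) \<inter> {..<m n} = A n" "m n < m (Suc n)"
    "\<exists>k\<ge>m n. k \<in> A (Suc n)" "\<And>B. B \<inter> {..<m (Suc n)} = A (Suc n) \<Longrightarrow> B \<in> V n" for n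
    using f[THEN spec, of n] by (simp_all add: A_def m_def case_prod_beta)
  have "strict_mono m"
    using A(3) by (simp add: strict_mono_Suc_iff)
  \<comment> \<open>Later stages never change what is prescribed below \<open>m n\<close>.\<close>
  have coh: "A (n + i) \<inter> {..<m n} = A n" for n i
  proof (induction i)
    case 0
    show ?case using A(1) by auto
  next
    case (Suc i)
    have "m n \<le> m (n + i)"
      using \<open>strict_mono m\<close> by (simp add: strict_mono_less_eq)
    then have "A (n + Suc i) \<inter> {..<m n} = (A (Suc (n + i)) \<inter> {..<m (n + i)}) \<inter> {..<m n}"
      by auto
    then show ?case
      using Suc A(2) by simp
  qed
  define B where "B = (\<Union>n. A n)"
  have B: "B \<inter> {..<m n} = A n" for n
  proof (intro equalityI subsetI)
    fix k assume "k \<in> B \<inter> {..<m n}"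
    then obtain i where i: "k \<in> A i" "k < m n" by (auto simp: B_def)
    show "k \<in> A n"
    proof (cases "n \<le> i")
      case True
      then show ?thesis using coh[of n "i - n"] i by auto
    next
      case False
      then show ?thesis using coh[of i "n - i"] i by auto
    qed
  qed (use A(1) in \<open>auto simp: B_def\<close>)
  \<comment> \<open>Stage \<open>Suc i\<close> has an element at or above \<open>m i\<close>, which
    is at least \<open>i\<close>.\<close>
  have "infinite B"
    unfolding infinite_nat_iff_unbounded_le
  proof
    fix i
    obtain k where "k \<ge> m i" "k \<in> A (Suc i)" using A(4) by blast
    moreover have "i \<le> m i"
      using \<open>strict_mono m\<close> by (rule strict_mono_imp_increasing)
    ultimately show "\<exists>k\<ge>i. k \<in> B"
      unfolding B_def by (meson UN_I UNIV_I order_trans)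
  qed
  moreover have "B \<in> V n" for n
    using A(5) B by blast
  ultimately show ?thesis by blast
qed

theorem corollary2p6:
  shows "\<exists>P :: nat set gorder.
           omega_algebraic_domain P \<and> \<not> gdelta_in (scott_space P) (maximal_elements P)"
proof (intro exI conjI notI)
  let ?P = "inclusion_order token_family"
  show "omega_algebraic_domain ?P"
    by (rule token.omega_algebraic_domain_inclusion_order) simp
  assume "gdelta_in (scott_space ?P) (maximal_elements ?P)"
  then obtain U :: "nat \<Rightarrow> nat set set" where
    U: "\<And>n. scott_open ?P (U n)" "maximal_elements ?P = (\<Inter>n. U n)"
    unfolding gdelta_in_scott_space by blast
  \<comment> \<open>The preimages of the \<open>U n\<close> are open in the Cantor space and contain
    all finite sets. The infinite \<open>B\<close> obtained would make \<open>total_member B\<close>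
    maximal.\<close>
  have "\<exists>B. infinite B \<and> (\<forall>n. B \<in> total_member -` U n)"
  proof (rule infinite_set_in_countable_Int)
    fix n A assume "A \<in> total_member -` U n"
    then show "\<exists>m. \<forall>B. B \<inter> {..<m} = A \<inter> {..<m} \<longrightarrow> B \<in> total_member -` U n"
      using scott_open_total_member[OF U(1)] by simp
  next
    fix n and A :: "nat set" assume "finite A"
    then show "A \<in> total_member -` U n"
      using total_member_maximal_if_finite U(2) by auto
  qed
  then show False
    using total_member_not_maximal_if_infinite U(2) by auto
qed

end
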